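(* Let $\mathcal H$ be a real Hilbert space, $A:\mathcal H\to\mathcal H$ single-valued and continuously differentiable, $B:\mathcal H\rightrightarrows 2^{\mathcal H}$ maximal monotone, and suppose the solution set $\mathcal S=\{x:0\in(A+B)(x)\}$ is nonempty and closed. Assume that for some $\epsilon,\kappa>0$, $$\operatorname{dist}(x,\mathcal S)\le\kappa\,r(x)\qquad\forall x\in V:=\{x:r(x)\le\epsilon\},$$ that $A$ is $L$-Lipschitz continuous in $V$ for some $L\ge0$, and that $\nabla A$ is uniformly continuous in $V$. Let $\omega_1$ be a nondecreasing and subadditive modulus of continuity of $\nabla A$ on $V$, i.e. $\omega_1:[0,\infty)\to[0,\infty)$ satisfies $\lim_{s\downarrow0}\omega_1(s)=\omega_1(0)=0$ and $\|\nabla A(x)-\nabla A(y)\|\le\omega_1(\|x-y\|)$ for all $x,y\in V$. Let $\omega_2:[0,\infty)\to[0,\infty)$ be a given nondecreasing, subadditive and continuous function that vanishes at zero, and let $c>0$, $\nu\ge0$. Consider a sequence $\{x_t\}$ generated by the scheme described in the context, with $$\mu_t=c\,\omega_2(r_t),\qquad \|J_t-\nabla A(x_t)\|=O(\omega_2(r_t)),\qquad \hat r_t(x_{t+1})\le\nu\,\omega_2(r_t)\,r_t .$$ If $\omega_1(s)\le\beta_1\,\omega_2(s)$ for some $\beta_1>0$ and all $s\ge0$, then, provided $r_0$ is sufficiently small, $r_{t+1}=o(r_t)$, $d_{t+1}=o(d_t)$, and $\{x_t\}$ converges strongly to a point in $\mathcal S$.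
   Context: Notation: $\mathrm{Id}$ is the identity on $\mathcal H$; $R(x):=x-(\mathrm{Id}+B)^{-1}(\mathrm{Id}-A)(x)$, $r(x):=\|R(x)\|$, so $\mathcal S=\{x:R(x)=0\}$; $r_t:=r(x_t)$, $d_t:=\operatorname{dist}(x_t,\mathcal S)$. The scheme: at iterate $x_t$, $H_t:=\mu_t\mathrm{Id}+J_t$, where $J_t$ is a bounded linear operator on $\mathcal H$ that is positive semidefinite ($\langle J_tv,v\rangle\ge0$ for all $v$) but possibly non-Hermitian, and $\mu_t$, $J_t$ satisfy the conditions in the claim (with the $O$ constant independent of $t$). The subproblem residual is $$\hat r_t(x):=\left\|x-(\mathrm{Id}+B)^{-1}\big((\mathrm{Id}-H_t)(x)+(H_t-A)(x_t)\big)\right\|,$$ which vanishes at the exact step $(H_t+B)^{-1}(H_t-A)(x_t)$. The next iterate $x_{t+1}$ is any point satisfying the displayed inexactness condition in the claim. The iteration is stopped if $r(x_t)=0$ (then $x_t\in\mathcal S$, and the sequence is regarded as constant from then on), so $r(x_t)>0$ whenever a step is taken. $\sigma_t=o(\tau_t)$ means: for every $\beta>0$, $\sigma_t\le\beta\tau_t$ for all $t$ sufficiently large. *)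

theory Defs
  imports "HOL-Analysis.Analysis" "HOL-Library.Landau_Symbols"
begin

definition monotone_operator :: "('a::real_inner \<Rightarrow> 'a set) \<Rightarrow> bool" where
  "monotone_operator B \<longleftrightarrow>
     (\<forall>x y. \<forall>u\<in>B x. \<forall>v\<in>B y. (u - v) \<bullet> (x - y) \<ge> 0)"

definition maximal_monotone :: "('a::real_inner \<Rightarrow> 'a set) \<Rightarrow> bool" where
  "maximal_monotone B \<longleftrightarrow> monotone_operator B \<and>
     (\<forall>B'. monotone_operator B' \<and> (\<forall>x. B x \<subseteq> B' x) \<longrightarrow> B' = B)"

text \<open>
  \<open>resolvent B\<close> is \<open>(Id + B)\<^sup>-\<^sup>1\<close>: the point \<open>y\<close> with \<open>z \<in> y + B y\<close>. If \<open>B\<close> is maximal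
  monotone on a Hilbert space, this point is unique by monotonicity and exists for every
  \<open>z\<close> by Minty's theorem.
\<close>

definition resolvent :: "('a::real_inner \<Rightarrow> 'a set) \<Rightarrow> 'a \<Rightarrow> 'a" where
  "resolvent B z = (THE y. z \<in> (\<lambda>b. y + b) ` B y)"

definition solution_set :: "('a::real_inner \<Rightarrow> 'a) \<Rightarrow> ('a \<Rightarrow> 'a set) \<Rightarrow> 'a set" where
  "solution_set A B = {x. 0 \<in> (\<lambda>b. A x + b) ` B x}"

definition residual :: "('a::real_inner \<Rightarrow> 'a) \<Rightarrow> ('a \<Rightarrow> 'a set) \<Rightarrow> 'a \<Rightarrow> real" where
  "residual A B x = norm (x - resolvent B (x - A x))"

text \<open>
  Residual at \<open>x\<close> of the subproblem \<open>0 \<in> H (x - xt) + A xt + B x\<close>, the linearization at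
  the current iterate \<open>xt\<close>.
\<close>

definition sub_residual ::
    "('a::real_inner \<Rightarrow> 'a) \<Rightarrow> ('a \<Rightarrow> 'a set) \<Rightarrow> ('a \<Rightarrow>\<^sub>L 'a) \<Rightarrow> 'a \<Rightarrow> 'a \<Rightarrow> real" where
  "sub_residual A B H xt x = norm (x - resolvent B ((x - H x) + (H xt - A xt)))"

text \<open>
  The sequence \<open>x\<close> is generated by the inexact regularized Newton scheme. \<open>J t\<close> need not be
  self-adjoint, and \<open>K\<close> is the constant of the bound \<open>\<parallel>J t - A' (x t)\<parallel> = O(\<omega> (r t))\<close>. Once
  the residual vanishes the iteration is stopped: \<open>x\<close> is constant from then on, and
  \<open>\<mu> t\<close>, \<open>J t\<close> are unconstrained.
\<close>

definition newton_sequence ::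
    "('a::real_inner \<Rightarrow> 'a) \<Rightarrow> ('a \<Rightarrow> 'a \<Rightarrow>\<^sub>L 'a) \<Rightarrow> ('a \<Rightarrow> 'a set) \<Rightarrow> (real \<Rightarrow> real) \<Rightarrow>
     real \<Rightarrow> real \<Rightarrow> real \<Rightarrow>
     (nat \<Rightarrow> 'a) \<Rightarrow> (nat \<Rightarrow> real) \<Rightarrow> (nat \<Rightarrow> 'a \<Rightarrow>\<^sub>L 'a) \<Rightarrow> bool" where
  "newton_sequence A A' B \<omega> c \<nu> K x \<mu> J \<longleftrightarrow>
     (\<forall>t. let r = residual A B (x t); H = \<mu> t *\<^sub>R id_blinfun + J t in
        if r = 0 then x (Suc t) = x t
        else \<mu> t = c * \<omega> r \<and>
             (\<forall>v. J t v \<bullet> v \<ge> 0) \<and>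
             norm (J t - A' (x t)) \<le> K * \<omega> r \<and>
             sub_residual A B H (x t) (x (Suc t)) \<le> \<nu> * \<omega> r * r)"

end

theory Submission
  imports Defs
begin

text \<open>
  Minty's theorem makes the resolvent a nonexpansive map. Testing the monotonicity of \<open>B\<close> at the
  new iterate and at a solution \<open>p\<close> within \<open>2 \<kappa> r\<^sub>t\<close> of \<open>x\<^sub>t\<close>, the strong monotonicity modulus
  \<open>\<mu>\<^sub>t = c \<omega>\<^sub>2(r\<^sub>t)\<close> of \<open>H\<^sub>t\<close> is matched by errors of size \<open>O(\<omega>\<^sub>2(r\<^sub>t) r\<^sub>t)\<close>, so the step has length
  \<open>O(r\<^sub>t)\<close>. Since \<open>H\<^sub>t\<close> differs from the derivative by \<open>O(\<omega>\<^sub>2(r\<^sub>t))\<close>, the new residual is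
  \<open>O(\<omega>\<^sub>2(r\<^sub>t) r\<^sub>t)\<close>. This gives superlinear decrease and a Cauchy sequence; the residual and the
  distance are equivalent near the solution set, which transfers the rate to the distance.
  If \<open>\<omega>\<^sub>2(r\<^sub>t) = 0\<close> the problem is locally affine and one step lands in the solution set.
\<close>

section \<open>Minty's theorem: minimization over closed convex sets, applied to an epigraph\<close>

lemma bounded_below_minimiser:
  fixes E :: "('b::{real_inner, complete_space} \<times> real) set"
  assumes "closed E" "convex E" "E \<noteq> {}"
    and nonneg: "\<And>z s. (z, s) \<in> E \<Longrightarrow> 0 \<le> s + (norm z)\<^sup>2 / 2"
  obtains z0 s0 where "(z0, s0) \<in> E"
    "\<And>z s. (z, s) \<in> E \<Longrightarrow> s0 + (norm z0)\<^sup>2 / 2 \<le> s + (norm z)\<^sup>2 / 2"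
proof -
  define \<phi> where "\<phi> = (\<lambda>p::'b \<times> real. snd p + (norm (fst p))\<^sup>2 / 2)"
  define m where "m = (INF p\<in>E. \<phi> p)"
  have bdd: "bdd_below (\<phi> ` E)"
    by (rule bdd_belowI[of _ 0]) (auto simp: \<phi>_def intro: nonneg)
  have m_le: "m \<le> \<phi> p" if "p \<in> E" for p
    unfolding m_def using bdd that by (rule cINF_lower)
  have "\<exists>p\<in>E. \<phi> p < m + inverse (real (Suc n))" for n
  proof -
    have "m < m + inverse (real (Suc n))" by simp
    then show ?thesis
      unfolding m_def using cINF_less_iff[OF \<open>E \<noteq> {}\<close> bdd] by blast
  qed
  then obtain p where pE: "\<And>n. p n \<in> E" and p_less: "\<And>n. \<phi> (p n) < m + inverse (real (Suc n))"
    by metis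
  have phi_lim: "(\<lambda>n. \<phi> (p n)) \<longlonglongrightarrow> m"
  proof (rule tendsto_sandwich)
    show "(\<lambda>n. m) \<longlonglongrightarrow> m" by simp
    show "(\<lambda>n. m + inverse (real (Suc n))) \<longlonglongrightarrow> m"
      using tendsto_add[OF tendsto_const LIMSEQ_inverse_real_of_nat] by simp
  qed (use m_le pE p_less in \<open>auto intro!: always_eventually less_imp_le\<close>)
  have gap: "(dist (fst (p i)) (fst (p j)))\<^sup>2 \<le> 4 * (\<phi> (p i) - m) + 4 * (\<phi> (p j) - m)" for i j
  proof -
    have "(1/2) *\<^sub>R p i + (1/2) *\<^sub>R p j \<in> E"
      using \<open>convex E\<close> pE by (intro convexD) auto
    from m_le[OF this]
    have "m \<le> (snd (p i) + snd (p j)) / 2 + (norm ((1/2) *\<^sub>R (fst (p i) + fst (p j))))\<^sup>2 / 2"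
      by (simp add: \<phi>_def scaleR_add_right add_divide_distrib)
    then have "m \<le> (snd (p i) + snd (p j)) / 2 + (norm (fst (p i) + fst (p j)))\<^sup>2 / 8"
      by (simp add: power_mult_distrib power2_eq_square)
    moreover have "(norm (fst (p i) + fst (p j)))\<^sup>2 + (norm (fst (p i) - fst (p j)))\<^sup>2
        = 2 * (norm (fst (p i)))\<^sup>2 + 2 * (norm (fst (p j)))\<^sup>2"
      by (simp add: power2_norm_eq_inner inner_add_left inner_add_right inner_diff_left inner_diff_right)
    ultimately show ?thesis
      unfolding \<phi>_def dist_norm by argo
  qed
  have "Cauchy (\<lambda>n. fst (p n))"
  proof (rule metric_CauchyI)
    fix e :: real assume "0 < e"
    then have "\<forall>\<^sub>F n in sequentially. \<phi> (p n) < m + e\<^sup>2 / 8"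
      using order_tendstoD(2)[OF phi_lim, of "m + e\<^sup>2 / 8"] by simp
    then obtain N where N: "\<And>n. n \<ge> N \<Longrightarrow> \<phi> (p n) < m + e\<^sup>2 / 8"
      unfolding eventually_sequentially by blast
    have "dist (fst (p i)) (fst (p j)) < e" if "i \<ge> N" "j \<ge> N" for i j
    proof -
      have "(dist (fst (p i)) (fst (p j)))\<^sup>2 < e\<^sup>2"
        using gap[of i j] N[OF that(1)] N[OF that(2)] by argo
      then show ?thesis using \<open>0 < e\<close> by (simp add: power2_less_imp_less)
    qed
    then show "\<exists>M. \<forall>i\<ge>M. \<forall>j\<ge>M. dist (fst (p i)) (fst (p j)) < e" by blast
  qed
  then obtain z0 where z0: "(\<lambda>n. fst (p n)) \<longlonglongrightarrow> z0"
    using Cauchy_convergent convergent_def by blast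
  have "(\<lambda>n. \<phi> (p n) - (norm (fst (p n)))\<^sup>2 / 2) \<longlonglongrightarrow> m - (norm z0)\<^sup>2 / 2"
    by (intro tendsto_intros phi_lim z0) auto
  then have "(\<lambda>n. snd (p n)) \<longlonglongrightarrow> m - (norm z0)\<^sup>2 / 2"
    by (simp add: \<phi>_def)
  then have "(\<lambda>n. (fst (p n), snd (p n))) \<longlonglongrightarrow> (z0, m - (norm z0)\<^sup>2 / 2)"
    by (rule tendsto_Pair[OF z0])
  then have "(z0, m - (norm z0)\<^sup>2 / 2) \<in> E"
    using closed_sequentially[OF \<open>closed E\<close>, of p] pE by simp
  then show thesis
    by (rule that) (use m_le in \<open>force simp: \<phi>_def\<close>)
qed

text \<open>First-order optimality. If the inequality failed by \<open>a > 0\<close>, moving by a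
  fraction \<open>\<theta>\<close> towards \<open>(z, s)\<close> would change the objective by
  \<open>\<theta> * (\<theta> * D / 2 - a)\<close>. The choice of \<open>\<theta>\<close> ensures
  \<open>\<theta> * D \<le> a\<close>, so this change would be negative.\<close>

lemma minimiser_variational:
  fixes E :: "('b::real_inner \<times> real) set"
  assumes "convex E" and z0: "(z0, s0) \<in> E" and z: "(z, s) \<in> E"
    and min: "\<And>z s. (z, s) \<in> E \<Longrightarrow> s0 + (norm z0)\<^sup>2 / 2 \<le> s + (norm z)\<^sup>2 / 2"
  shows "s0 \<le> s + z0 \<bullet> (z - z0)"
proof (rule ccontr)
  define a where "a = s0 - s - z0 \<bullet> (z - z0)"
  define D where "D = (norm (z - z0))\<^sup>2"
  define \<theta> where "\<theta> = a / (a + D)"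
  assume "\<not> ?thesis"
  then have "0 < a" by (simp add: a_def)
  moreover have "0 \<le> D" by (simp add: D_def)
  ultimately have \<theta>: "0 < \<theta>" "\<theta> \<le> 1" "\<theta> * D \<le> a"
    by (auto simp: \<theta>_def divide_simps algebra_simps)
  have "(1 - \<theta>) *\<^sub>R (z0, s0) + \<theta> *\<^sub>R (z, s) \<in> E"
    using \<open>convex E\<close> z0 z \<theta> by (intro convexD) auto
  then have "(z0 + \<theta> *\<^sub>R (z - z0), s0 + \<theta> * (s - s0)) \<in> E"
    by (simp add: algebra_simps)
  from min[OF this] have "s0 + (norm z0)\<^sup>2 / 2
      \<le> s0 + \<theta> * (s - s0) + (norm (z0 + \<theta> *\<^sub>R (z - z0)))\<^sup>2 / 2" .
  moreover have "(norm (z0 + \<theta> *\<^sub>R d))\<^sup>2 = (norm z0)\<^sup>2 + 2 * \<theta> * (z0 \<bullet> d) + \<theta>\<^sup>2 * (norm d)\<^sup>2" for d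
    unfolding power2_norm_eq_inner
    by (simp add: inner_add_left inner_add_right inner_commute power2_eq_square)
  note this[of "z - z0"]
  ultimately have "0 \<le> \<theta> * (s - s0) + \<theta> * (z0 \<bullet> (z - z0)) + \<theta>\<^sup>2 * D / 2"
    unfolding D_def right_diff_distrib by argo
  also have "\<dots> = \<theta> * (\<theta> * D / 2 - a)"
    by (simp add: a_def power2_eq_square algebra_simps)
  finally have "a \<le> \<theta> * D / 2"
    using \<theta>(1) by (simp add: zero_le_mult_iff)
  then show False using \<theta>(3) \<open>0 < a\<close> by simp
qed

text \<open>Adding the single pair \<open>(x, u)\<close> to the graph keeps it monotone, so
  maximality says it was already there. Maximality is exploited below in this form.\<close>

lemma maximal_monotone_mem:
  assumes "maximal_monotone B"
    and rel: "\<And>y v. v \<in> B y \<Longrightarrow> 0 \<le> (v - u) \<bullet> (y - x)"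
  shows "u \<in> B x"
proof -
  define B' where "B' = B(x := insert u (B x))"
  have mon: "monotone_operator B"
    using assms(1) by (simp add: maximal_monotone_def)
  have rel': "0 \<le> (u - v) \<bullet> (x - y)" if "v \<in> B y" for y v
    using rel[OF that] by (simp add: inner_diff_left inner_diff_right)
  have "monotone_operator B'"
    using mon rel rel' unfolding monotone_operator_def B'_def by auto
  moreover have "\<forall>x. B x \<subseteq> B' x" by (auto simp: B'_def)
  ultimately have "B' = B" using assms(1) by (simp add: maximal_monotone_def)
  then show ?thesis by (metis B'_def fun_upd_same insertI1)
qed

text \<open>
  \<open>E\<close> is the epigraph of the Fitzpatrick function of \<open>B\<close>. If \<open>((x0, u0), s0)\<close> minimizes
  \<open>s + (\<parallel>x\<parallel>\<^sup>2 + \<parallel>u\<parallel>\<^sup>2) / 2\<close> over \<open>E\<close>, then \<open>- x0 \<in> B (- u0)\<close> and \<open>x0 = - u0\<close>.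
\<close>
lemma minty_zero:
  fixes B :: "'a::{real_inner, complete_space} \<Rightarrow> 'a set"
  assumes B: "maximal_monotone B"
  shows "\<exists>x. - x \<in> B x"
proof -
  define E where "E = {((x, u), s) | x u s. \<forall>y. \<forall>v\<in>B y. x \<bullet> v + y \<bullet> u - y \<bullet> v \<le> s}"
  have E_iff: "((x, u), s) \<in> E \<longleftrightarrow> (\<forall>y. \<forall>v\<in>B y. x \<bullet> v + y \<bullet> u - y \<bullet> v \<le> s)" for x u s
    by (auto simp: E_def)
  have mon: "0 \<le> (u - v) \<bullet> (x - y)" if "u \<in> B x" "v \<in> B y" for x y u v
    using B that by (auto simp: maximal_monotone_def monotone_operator_def)
  have graph: "((y, v), y \<bullet> v) \<in> E" if "v \<in> B y" for y v
    unfolding E_iff using mon[OF that]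
    by (force simp: inner_diff_left inner_diff_right inner_commute)
  \<comment> \<open>The Fitzpatrick function dominates the duality pairing: otherwise
    \<open>(x, u)\<close> would be monotonically related to the whole graph, hence in it, and the
    defining inequality of \<open>E\<close> at \<open>(x, u)\<close> itself would give the
    bound.\<close>
  have above: "x \<bullet> u \<le> s" if "((x, u), s) \<in> E" for x u s
  proof (rule ccontr)
    assume "\<not> x \<bullet> u \<le> s"
    have "u \<in> B x"
    proof (rule maximal_monotone_mem[OF B])
      fix y v assume "v \<in> B y"
      then have "x \<bullet> v + y \<bullet> u - y \<bullet> v \<le> s" using that by (simp add: E_iff)
      then show "0 \<le> (v - u) \<bullet> (y - x)"
        using \<open>\<not> x \<bullet> u \<le> s\<close> by (simp add: inner_diff_left inner_diff_right inner_commute)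
    qed
    with that have "x \<bullet> u + x \<bullet> u - x \<bullet> u \<le> s" by (simp only: E_iff)
    then show False using \<open>\<not> x \<bullet> u \<le> s\<close> by simp
  qed
  have half: "E = (\<Inter>y. \<Inter>v\<in>B y. {q. fst (fst q) \<bullet> v + y \<bullet> snd (fst q) - y \<bullet> v \<le> snd q})"
    by (force simp: E_def)
  have "closed E"
    unfolding half by (intro closed_INT ballI closed_Collect_le continuous_intros)
  have "convex E"
    unfolding convex_alt
  proof (intro ballI allI impI)
    fix p q :: "('a \<times> 'a) \<times> real" and \<theta> :: real
    assume pq: "p \<in> E" "q \<in> E" and \<theta>: "0 \<le> \<theta> \<and> \<theta> \<le> 1"
    obtain x u s x' u' s' where p: "p = ((x, u), s)" and q: "q = ((x', u'), s')"
      by (metis prod.exhaust)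
    show "(1 - \<theta>) *\<^sub>R p + \<theta> *\<^sub>R q \<in> E"
      unfolding p q scaleR_Pair add_Pair E_iff
    proof (intro allI ballI)
      fix y v assume v: "v \<in> B y"
      have "(1 - \<theta>) * (x \<bullet> v + y \<bullet> u - y \<bullet> v) + \<theta> * (x' \<bullet> v + y \<bullet> u' - y \<bullet> v)
          \<le> (1 - \<theta>) * s + \<theta> * s'"
        using pq v \<theta> unfolding p q E_iff by (intro add_mono mult_left_mono) auto
      then show "((1 - \<theta>) *\<^sub>R x + \<theta> *\<^sub>R x') \<bullet> v + y \<bullet> ((1 - \<theta>) *\<^sub>R u + \<theta> *\<^sub>R u') - y \<bullet> v
          \<le> (1 - \<theta>) *\<^sub>R s + \<theta> *\<^sub>R s'"
        by (simp add: inner_add_left inner_add_right algebra_simps)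
    qed
  qed
  \<comment> \<open>With an empty graph, the membership criterion would hold vacuously at
    \<open>(0, 0)\<close>.\<close>
  have "\<exists>y v. v \<in> B y"
    using maximal_monotone_mem[OF B, of 0 0] by blast
  then have "E \<noteq> {}" using graph by blast
  have norm_pair: "(norm (x, u))\<^sup>2 = x \<bullet> x + u \<bullet> u" for x u :: 'a
    by (simp add: power2_norm_eq_inner inner_Pair)
  have sq: "0 \<le> (x + u) \<bullet> (x + u)" for x u :: 'a by simp
  obtain x0 u0 s0 where min: "((x0, u0), s0) \<in> E"
    "\<And>z s. (z, s) \<in> E \<Longrightarrow> s0 + (norm (x0, u0))\<^sup>2 / 2 \<le> s + (norm z)\<^sup>2 / 2"
  proof (rule bounded_below_minimiser[OF \<open>closed E\<close> \<open>convex E\<close> \<open>E \<noteq> {}\<close>])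
    fix z :: "'a \<times> 'a" and s assume "(z, s) \<in> E"
    then obtain x u where "z = (x, u)" "x \<bullet> u \<le> s" using above by (metis prod.exhaust)
    then show "0 \<le> s + (norm z)\<^sup>2 / 2"
      using sq[of x u] unfolding \<open>z = (x, u)\<close> norm_pair inner_add_left inner_add_right
      by (simp add: inner_commute[of u x] field_simps)
  qed (metis prod.exhaust)
  \<comment> \<open>The optimality inequality is tested at the graph points of \<open>B\<close>, and
    \<open>s0\<close> is bounded below by \<open>x0 \<bullet> u0\<close>; completing the square
    leaves \<open>x0 + u0\<close>.\<close>
  have key: "(x0 + u0) \<bullet> (x0 + u0) \<le> (v - (- x0)) \<bullet> (y - (- u0))" if "v \<in> B y" for y v
  proof -
    have "s0 \<le> y \<bullet> v + (x0, u0) \<bullet> ((y, v) - (x0, u0))"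
      by (rule minimiser_variational[OF \<open>convex E\<close> min(1) graph[OF that] min(2)])
    then show ?thesis
      using above[OF min(1)]
      by (simp add: inner_add_left inner_add_right inner_diff_right inner_commute)
  qed
  have mem: "- x0 \<in> B (- u0)"
  proof (rule maximal_monotone_mem[OF B])
    show "0 \<le> (v - (- x0)) \<bullet> (y - (- u0))" if "v \<in> B y" for y v
      using key[OF that] sq[of x0 u0] by linarith
  qed
  \<comment> \<open>At the graph point just found the right-hand side of \<open>key\<close> is
    zero.\<close>
  from key[OF this] have "x0 + u0 = 0" by (simp add: inner_gt_zero_iff flip: not_less)
  then have "- u0 = x0" by (simp add: add_eq_0_iff)
  then show ?thesis using mem by auto
qed

text \<open>Shifting the values of \<open>B\<close> by \<open>- z\<close> preserves maximal
  monotonicity and reduces the claim to \<open>minty_zero\<close>.\<close>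

theorem minty:
  fixes B :: "'a::{real_inner, complete_space} \<Rightarrow> 'a set"
  assumes B: "maximal_monotone B"
  shows "\<exists>y. z - y \<in> B y"
proof -
  define C where "C = (\<lambda>y. {v. v + z \<in> B y})"
  have "maximal_monotone C"
    unfolding maximal_monotone_def
  proof (intro conjI allI impI)
    have mon: "0 \<le> (u - v) \<bullet> (x - y)" if "u \<in> B x" "v \<in> B y" for x y u v
      using B that by (auto simp: maximal_monotone_def monotone_operator_def)
    show "monotone_operator C"
      unfolding monotone_operator_def
    proof (intro allI ballI)
      fix x y u v assume "u \<in> C x" "v \<in> C y"
      then show "0 \<le> (u - v) \<bullet> (x - y)"
        using mon[of "u + z" x "v + z" y] by (simp add: C_def)
    qed
    fix C' assume C': "monotone_operator C' \<and> (\<forall>x. C x \<subseteq> C' x)"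
    have "C' y \<subseteq> C y" for y
    proof
      fix u assume "u \<in> C' y"
      have "u + z \<in> B y"
      proof (rule maximal_monotone_mem[OF B])
        fix x v assume "v \<in> B x"
        then have "v - z \<in> C x" by (simp add: C_def)
        then have "v - z \<in> C' x" using C' by blast
        then have "0 \<le> (v - z - u) \<bullet> (x - y)"
          using C' \<open>u \<in> C' y\<close> unfolding monotone_operator_def by blast
        then show "0 \<le> (v - (u + z)) \<bullet> (x - y)" by (simp add: diff_diff_eq add.commute)
      qed
      then show "u \<in> C y" by (simp add: C_def)
    qed
    then show "C' = C" using C' by (intro ext equalityI) blast+
  qed
  from minty_zero[OF this] show ?thesis by (auto simp: C_def)
qed

section \<open>The resolvent, and sequences with geometrically decaying steps\<close>

lemma resolvent_eqI:
  assumes "monotone_operator B" "z - y \<in> B y"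
  shows "resolvent B z = y"
  unfolding resolvent_def
proof (rule the_equality)
  show "z \<in> (\<lambda>b. y + b) ` B y" using assms(2) by (force simp: image_iff)
  fix y' assume "z \<in> (\<lambda>b. y' + b) ` B y'"
  then have "z - y' \<in> B y'" by auto
  then have "0 \<le> ((z - y') - (z - y)) \<bullet> (y' - y)"
    using assms unfolding monotone_operator_def by blast
  moreover have "(z - y') - (z - y) = - (y' - y)" by simp
  ultimately have "(y' - y) \<bullet> (y' - y) \<le> 0" by (metis inner_minus_left neg_0_le_iff_le)
  then have "y' - y = 0" by (metis inner_gt_zero_iff not_less)
  then show "y' = y" by simp
qed

lemma resolvent_mem:
  fixes B :: "'a::{real_inner, complete_space} \<Rightarrow> 'a set"
  assumes "maximal_monotone B"
  shows "z - resolvent B z \<in> B (resolvent B z)"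
proof -
  obtain y where y: "z - y \<in> B y" using minty[OF assms] by blast
  moreover have "resolvent B z = y"
    using assms y by (intro resolvent_eqI) (auto simp: maximal_monotone_def)
  ultimately show ?thesis by simp
qed

text \<open>Monotonicity yields the firm estimate
  \<open>?d \<bullet> ?d \<le> (z - z') \<bullet> ?d\<close>; Cauchy-Schwarz does the rest.\<close>

lemma resolvent_nonexpansive:
  fixes B :: "'a::{real_inner, complete_space} \<Rightarrow> 'a set"
  assumes B: "maximal_monotone B"
  shows "norm (resolvent B z - resolvent B z') \<le> norm (z - z')"
proof -
  let ?d = "resolvent B z - resolvent B z'"
  have "0 \<le> ((z - resolvent B z) - (z' - resolvent B z')) \<bullet> ?d"
    using B resolvent_mem[OF B] unfolding maximal_monotone_def monotone_operator_def by blast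
  then have "?d \<bullet> ?d \<le> (z - z') \<bullet> ?d"
    by (simp add: inner_diff_left algebra_simps)
  also have "\<dots> \<le> norm (z - z') * norm ?d" by (rule norm_cauchy_schwarz)
  finally have "norm ?d * norm ?d \<le> norm (z - z') * norm ?d"
    by (simp add: power2_norm_eq_inner[symmetric] power2_eq_square)
  then show ?thesis
    by (cases "?d = 0") simp_all
qed

lemma convergent_of_geometric_steps:
  fixes x :: "nat \<Rightarrow> 'a::{real_normed_vector, complete_space}"
  assumes step: "\<And>n. norm (x (Suc n) - x n) \<le> a * q ^ n" and q: "0 \<le> q" "q < 1"
  shows "convergent x"
proof -
  define s where "s = (\<lambda>n. \<Sum>i<n. a * q ^ i)"
  have "summable (\<lambda>n. a * q ^ n)"
    using q by (intro summable_mult summable_geometric) auto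
  then have "Cauchy s"
    unfolding s_def summable_iff_convergent by (rule convergent_Cauchy)
  have le: "dist (x (m + k)) (x m) \<le> s (m + k) - s m" for m k
  proof (induction k)
    case (Suc k)
    have "dist (x (m + Suc k)) (x m) \<le> dist (x (Suc (m + k))) (x (m + k)) + dist (x (m + k)) (x m)"
      using dist_triangle by simp
    with Suc step[of "m + k"] show ?case by (simp add: s_def dist_norm)
  qed simp
  have bound: "dist (x n) (x m) \<le> dist (s n) (s m)" if "m \<le> n" for m n
    using le[of m "n - m"] that by (simp add: dist_real_def)
  have "Cauchy x"
  proof (rule metric_CauchyI)
    fix e :: real assume "0 < e"
    then obtain N where "\<And>i j. N \<le> i \<Longrightarrow> N \<le> j \<Longrightarrow> dist (s i) (s j) < e"
      using metric_CauchyD[OF \<open>Cauchy s\<close>] by blast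
    then have "dist (x i) (x j) < e" if "N \<le> i" "N \<le> j" for i j
      using that bound[of i j] bound[of j i] by (metis dist_commute linear order.strict_trans1)
    then show "\<exists>N. \<forall>i\<ge>N. \<forall>j\<ge>N. dist (x i) (x j) < e" by blast
  qed
  then show ?thesis by (rule Cauchy_convergent)
qed

section \<open>The setting, and regularity of the residual\<close>

text \<open>Here \<open>\<omega>\<close> stands for \<open>\<omega>\<^sub>2\<close>, and the modulus
  \<open>\<omega>\<^sub>1\<close> has been replaced by its bound \<open>\<beta> * \<omega>\<close>,
  so that all errors are measured by one function.\<close>

locale newton_setting =
  fixes A :: "'a::{real_inner, complete_space} \<Rightarrow> 'a"
    and A' :: "'a \<Rightarrow> 'a \<Rightarrow>\<^sub>L 'a"
    and B :: "'a \<Rightarrow> 'a set"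
    and \<omega> :: "real \<Rightarrow> real"
    and \<epsilon> \<kappa> L \<beta> c \<nu> K :: real
  assumes A_deriv: "\<And>x. (A has_derivative blinfun_apply (A' x)) (at x)"
    and B_max: "maximal_monotone B"
    and S_nonempty: "solution_set A B \<noteq> {}"
    and eps_pos: "0 < \<epsilon>" and kappa_pos: "0 < \<kappa>"
    and error_bound:
      "\<And>x. residual A B x \<le> \<epsilon> \<Longrightarrow> infdist x (solution_set A B) \<le> \<kappa> * residual A B x"
    and A_lipschitz: "L-lipschitz_on {x. residual A B x \<le> \<epsilon>} A"
    and modulus: "\<And>x y. residual A B x \<le> \<epsilon> \<Longrightarrow> residual A B y \<le> \<epsilon> \<Longrightarrow>
      norm (A' x - A' y) \<le> \<beta> * \<omega> (norm (x - y))"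
    and omega_nonneg: "\<And>s. 0 \<le> s \<Longrightarrow> 0 \<le> \<omega> s"
    and omega_mono: "mono_on {0..} \<omega>"
    and omega_subadd: "\<And>s t. 0 \<le> s \<Longrightarrow> 0 \<le> t \<Longrightarrow> \<omega> (s + t) \<le> \<omega> s + \<omega> t"
    and omega_cont: "continuous_on {0..} \<omega>"
    and omega_zero: "\<omega> 0 = 0"
    and beta_pos: "0 < \<beta>" and c_pos: "0 < c" and nu_nonneg: "0 \<le> \<nu>" and K_nonneg: "0 \<le> K"
begin

abbreviation r where "r \<equiv> residual A B"
abbreviation S where "S \<equiv> solution_set A B"

lemma B_mono: "u \<in> B x \<Longrightarrow> v \<in> B y \<Longrightarrow> 0 \<le> (u - v) \<bullet> (x - y)"
  using B_max unfolding maximal_monotone_def monotone_operator_def by blast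

lemma resolvent_eq: "z - y \<in> B y \<Longrightarrow> resolvent B z = y"
  by (rule resolvent_eqI) (use B_max in \<open>auto simp: maximal_monotone_def\<close>)

lemma L_nonneg: "0 \<le> L"
  using A_lipschitz by (rule lipschitz_on_nonneg)

lemma r_nonneg: "0 \<le> r x"
  by (simp add: residual_def)

lemma solution_iff: "x \<in> S \<longleftrightarrow> - A x \<in> B x"
proof -
  have "0 \<in> (\<lambda>b. A x + b) ` B x \<longleftrightarrow> - A x \<in> B x"
    by (force simp: image_iff add_eq_0_iff)
  then show ?thesis by (simp add: solution_set_def)
qed

lemma r_eq_0_iff: "r x = 0 \<longleftrightarrow> x \<in> S"
proof
  assume "r x = 0"
  then have "resolvent B (x - A x) = x" by (simp add: residual_def)
  with resolvent_mem[OF B_max, of "x - A x"] show "x \<in> S" by (simp add: solution_iff)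
next
  assume "x \<in> S"
  then have "resolvent B (x - A x) = x" by (intro resolvent_eq) (simp add: solution_iff)
  then show "r x = 0" by (simp add: residual_def)
qed

lemma r_le_r_add: "r x \<le> r y + 2 * norm (x - y) + norm (A x - A y)"
proof -
  have "norm (resolvent B (y - A y) - resolvent B (x - A x)) \<le> norm ((y - A y) - (x - A x))"
    by (rule resolvent_nonexpansive[OF B_max])
  also have "\<dots> = norm ((A x - A y) - (x - y))" by (simp add: algebra_simps)
  also have "\<dots> \<le> norm (A x - A y) + norm (x - y)" by (rule norm_triangle_ineq4)
  finally have "norm (resolvent B (y - A y) - resolvent B (x - A x)) \<le> norm (A x - A y) + norm (x - y)" .
  moreover have "x - resolvent B (x - A x) = (x - y) + ((y - resolvent B (y - A y))
      + (resolvent B (y - A y) - resolvent B (x - A x)))" by simp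
  ultimately show ?thesis
    unfolding residual_def by (smt (verit) norm_triangle_ineq)
qed

lemma r_lipschitz:
  assumes "r x \<le> \<epsilon>" "r y \<le> \<epsilon>"
  shows "r x \<le> r y + (2 + L) * norm (x - y)"
proof -
  have "norm (A x - A y) \<le> L * norm (x - y)"
    using lipschitz_onD[OF A_lipschitz, of x y] assms by (simp add: dist_norm)
  with r_le_r_add[of x y] show ?thesis by (simp add: algebra_simps)
qed

text \<open>In contrast to \<open>r_lipschitz\<close> this holds on the whole space. It permits the
  intermediate value argument at the boundary of the sublevel set and identifies the limit of the
  iterates as a solution.\<close>

lemma r_continuous: "continuous_on UNIV r"
proof -
  have "1-lipschitz_on UNIV (resolvent B)"
    using resolvent_nonexpansive[OF B_max] by (intro lipschitz_onI) (auto simp: dist_norm)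
  then have "continuous_on UNIV (resolvent B)" by (rule lipschitz_on_continuous_on)
  moreover have "continuous_on UNIV A"
    using A_deriv by (meson has_derivative_continuous continuous_at_imp_continuous_on)
  ultimately have "continuous_on UNIV (\<lambda>x. norm (x - resolvent B (x - A x)))"
    by (intro continuous_intros continuous_on_compose2[where f = "\<lambda>x. x - A x"]) auto
  then show ?thesis by (simp add: residual_def[abs_def])
qed

text \<open>Since \<open>(2 + L) * \<rho> = \<epsilon> / 4\<close>, a displacement of length
  \<open>\<rho>\<close> from \<open>r x \<le> \<epsilon> / 2\<close> leaves slack below
  \<open>\<epsilon>\<close>.\<close>

definition \<rho> where "\<rho> = \<epsilon> / (4 * (2 + L))"

lemma rho_pos: "0 < \<rho>"
  using eps_pos L_nonneg by (simp add: \<rho>_def)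

text \<open>
  The sublevel set of the residual need not be convex; this lemma keeps the segments used in
  the Taylor expansions inside it. The Lipschitz bound on \<open>r\<close> is only valid between points
  of the sublevel set, so it is applied at a point where \<open>r = \<epsilon>\<close>, given by the intermediate value theorem.
\<close>
lemma r_le_eps_near:
  assumes x: "r x \<le> \<epsilon> / 2" and h: "norm h \<le> \<rho>"
  shows "r (x + h) \<le> \<epsilon>"
proof (rule ccontr)
  assume "\<not> ?thesis"
  define g where "g = (\<lambda>\<theta>::real. r (x + \<theta> *\<^sub>R h))"
  have "continuous_on {0..1} g"
    unfolding g_def by (rule continuous_on_compose2[OF r_continuous]) (auto intro!: continuous_intros)
  moreover have "g 0 \<le> \<epsilon>" "\<epsilon> \<le> g 1"
    using x eps_pos \<open>\<not> r (x + h) \<le> \<epsilon>\<close> by (auto simp: g_def)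
  ultimately obtain \<theta> where \<theta>: "0 \<le> \<theta>" "\<theta> \<le> 1" "g \<theta> = \<epsilon>"
    using IVT'[of g 0 \<epsilon> 1] by auto
  have "\<epsilon> \<le> r x + (2 + L) * norm ((x + \<theta> *\<^sub>R h) - x)"
    using r_lipschitz[of "x + \<theta> *\<^sub>R h" x] x eps_pos \<theta> by (simp add: g_def)
  also have "\<dots> \<le> \<epsilon> / 2 + (2 + L) * \<rho>"
  proof -
    have "\<theta> * norm h \<le> 1 * \<rho>" using \<theta> h by (intro mult_mono) auto
    then show ?thesis using x L_nonneg \<theta> by (intro add_mono mult_left_mono) auto
  qed
  also have "\<dots> = \<epsilon> * 3 / 4"
    using L_nonneg by (simp add: \<rho>_def field_simps)
  finally show False using eps_pos by simp
qed

section \<open>Scaling of the modulus, Taylor estimates and the error bound\<close>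

lemma omega_le: "0 \<le> s \<Longrightarrow> s \<le> t \<Longrightarrow> \<omega> s \<le> \<omega> t"
  using omega_mono by (auto simp: mono_on_def)

lemma omega_of_nat_mult: "0 \<le> s \<Longrightarrow> \<omega> (real n * s) \<le> real n * \<omega> s"
proof (induction n)
  case (Suc n)
  then show ?case using omega_subadd[of s "real n * s"] by (simp add: algebra_simps)
qed (simp add: omega_zero)

text \<open>Subadditivity handles integer factors, and rounding \<open>C\<close> up costs the extra
  \<open>1\<close>. This turns lengths of order \<open>r x\<close> into moduli of order
  \<open>\<omega> (r x)\<close>.\<close>

lemma omega_mult:
  assumes "0 \<le> C" "0 \<le> s"
  shows "\<omega> (C * s) \<le> (C + 1) * \<omega> s"
proof -
  define n where "n = nat \<lceil>C\<rceil>"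
  have n: "C \<le> real n" "real n \<le> C + 1" using assms by (auto simp: n_def; linarith)+
  have "\<omega> (C * s) \<le> \<omega> (real n * s)"
    using assms n by (intro omega_le mult_right_mono) auto
  also have "\<dots> \<le> real n * \<omega> s" using assms by (intro omega_of_nat_mult)
  also have "\<dots> \<le> (C + 1) * \<omega> s" using n omega_nonneg assms by (intro mult_right_mono) auto
  finally show ?thesis .
qed

text \<open>The mean value inequality for \<open>A\<close> minus its linearization;
  \<open>r_le_eps_near\<close> keeps the segment where the modulus applies.\<close>

lemma taylor:
  assumes x: "r x \<le> \<epsilon> / 2" and h: "norm h \<le> \<rho>"
  shows "norm (A (x + h) - A x - A' x h) \<le> \<beta> * \<omega> (norm h) * norm h"
proof -
  have "norm (A (x + h) - A x - blinfun_apply (A' x) (x + h - x)) \<le> norm (x + h - x) * (\<beta> * \<omega> (norm h))"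
  proof (rule differentiable_bound_linearization[where f' = "\<lambda>y. blinfun_apply (A' y)" and S = "closed_segment x (x + h)"])
    show "x + t *\<^sub>R (x + h - x) \<in> closed_segment x (x + h)" if "t \<in> {0..1}" for t
      using that by (auto simp: closed_segment_def intro!: exI[of _ t]) (simp add: algebra_simps)
    show "(A has_derivative blinfun_apply (A' y)) (at y within closed_segment x (x + h))" for y
      using A_deriv by (rule has_derivative_at_withinI)
    show "onorm (blinfun_apply (A' y) - blinfun_apply (A' x)) \<le> \<beta> * \<omega> (norm h)"
      if "y \<in> closed_segment x (x + h)" for y
    proof -
      have near: "norm (y - x) \<le> norm h"
        using segment_bound[OF that] by simp
      have "norm (A' y - A' x) \<le> \<beta> * \<omega> (norm (y - x))"
        using r_le_eps_near[OF x, of "y - x"] near h x eps_pos by (intro modulus) auto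
      also have "\<dots> \<le> \<beta> * \<omega> (norm h)"
        using near beta_pos by (intro mult_left_mono omega_le) auto
      finally show ?thesis unfolding norm_blinfun.rep_eq minus_blinfun.rep_eq fun_diff_def .
    qed
  qed auto
  then show ?thesis by (simp add: mult.commute)
qed

text \<open>Each direction is rescaled to length \<open>\<rho>\<close>, where both the Lipschitz
  bound and \<open>taylor\<close> are available; the Taylor remainder accounts for
  \<open>\<beta> * \<omega> \<rho>\<close>.\<close>

lemma norm_A'_le:
  assumes x: "r x \<le> \<epsilon> / 2"
  shows "norm (A' x) \<le> L + \<beta> * \<omega> \<rho>"
proof (rule norm_blinfun_bound)
  show "0 \<le> L + \<beta> * \<omega> \<rho>"
    using L_nonneg beta_pos omega_nonneg[of \<rho>] rho_pos by simp
  fix v :: 'a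
  show "norm (A' x v) \<le> (L + \<beta> * \<omega> \<rho>) * norm v"
  proof (cases "v = 0")
    case False
    define h where "h = (\<rho> / norm v) *\<^sub>R v"
    have h: "norm h = \<rho>" using False rho_pos by (simp add: h_def)
    have "norm (A (x + h) - A x) \<le> L * \<rho>"
      using lipschitz_onD[OF A_lipschitz, of "x + h" x] r_le_eps_near[OF x, of h] x eps_pos h
      by (simp add: dist_norm)
    moreover have "norm (A' x h) \<le> norm (A (x + h) - A x - A' x h) + norm (A (x + h) - A x)"
      using norm_triangle_ineq4[of "A (x + h) - A x" "A (x + h) - A x - A' x h"] by simp
    ultimately have "norm (A' x h) \<le> (L + \<beta> * \<omega> \<rho>) * \<rho>"
      using taylor[OF x, of h] h by (simp add: algebra_simps)
    then have "\<rho> * norm (A' x v) \<le> \<rho> * ((L + \<beta> * \<omega> \<rho>) * norm v)"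
      using False rho_pos by (simp add: h_def blinfun.scaleR_right field_simps)
    then show ?thesis using rho_pos by simp
  qed simp
qed

text \<open>The distance to \<open>S\<close> may not be attained; doubling the error bound gives
  strict slack because \<open>r x\<close> is positive.\<close>

lemma near_solution:
  assumes "0 < r x" "r x \<le> \<epsilon>"
  obtains p where "p \<in> S" "norm (x - p) \<le> 2 * \<kappa> * r x"
proof -
  have "infdist x S < 2 * \<kappa> * r x"
    using error_bound[OF assms(2)] mult_pos_pos[OF kappa_pos assms(1)] by linarith
  then have "(INF p\<in>S. dist x p) < 2 * \<kappa> * r x"
    using S_nonempty by (simp add: infdist_notempty)
  then obtain p where "p \<in> S" "dist x p < 2 * \<kappa> * r x"
    using cInf_lessD[of "dist x ` S"] S_nonempty by auto
  then show thesis by (intro that) (auto simp: dist_norm)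
qed

text \<open>A converse to the error bound, from the Lipschitz estimate against points where
  \<open>r\<close> vanishes. It transfers the rate from residuals to distances.\<close>

lemma r_le_infdist:
  assumes "r x \<le> \<epsilon>"
  shows "r x \<le> (2 + L) * infdist x S"
proof -
  have "r x / (2 + L) \<le> (INF p\<in>S. dist x p)"
  proof (rule cINF_greatest[OF S_nonempty])
    fix p assume "p \<in> S"
    then have "r p = 0" by (simp add: r_eq_0_iff)
    then show "r x / (2 + L) \<le> dist x p"
      using r_lipschitz[OF assms, of p] eps_pos L_nonneg by (simp add: field_simps dist_norm)
  qed
  then show ?thesis using S_nonempty L_nonneg by (simp add: infdist_notempty field_simps)
qed


section \<open>Analysis of a single Newton step\<close>

definition newton_op :: "'a \<Rightarrow> ('a \<Rightarrow>\<^sub>L 'a) \<Rightarrow> ('a \<Rightarrow>\<^sub>L 'a)"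
  where "newton_op x J = (c * \<omega> (r x)) *\<^sub>R id_blinfun + J"

definition newton_step :: "'a \<Rightarrow> ('a \<Rightarrow>\<^sub>L 'a) \<Rightarrow> 'a \<Rightarrow> bool"
  where "newton_step x J x' \<longleftrightarrow> (\<forall>v. 0 \<le> J v \<bullet> v) \<and> norm (J - A' x) \<le> K * \<omega> (r x) \<and>
    sub_residual A B (newton_op x J) x x' \<le> \<nu> * \<omega> (r x) * r x"

text \<open>
  For a solution \<open>p\<close> near \<open>x\<close>, \<open>Q\<close> bounds the linearization error of \<open>A\<close> between \<open>x\<close> and
  \<open>p\<close> and \<open>M\<close> the operator \<open>newton_op x J\<close>; then \<open>C0\<close> bounds the distance of the new iterate
  to \<open>p\<close>, \<open>C1\<close> the step, and \<open>C2\<close> the decrease of the residual.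
\<close>
definition Q where "Q = 2 * \<kappa> * (c + K + \<beta> * (2 * \<kappa> + 1))"
definition M where "M = (c + K) * \<omega> \<epsilon> + (L + \<beta> * \<omega> \<rho>)"
definition C0 where "C0 = \<nu> * \<omega> \<epsilon> + (M * \<nu> + 2 * (\<nu> + Q)) / c"
definition C1 where "C1 = C0 + 2 * \<kappa>"
definition C2 where "C2 = \<nu> + \<beta> * (C1 + 1) * C1 + (c + K) * C1"

lemma constants_nonneg: "0 \<le> Q" "0 \<le> M" "0 \<le> C0" "0 < C1" "0 \<le> C2" "2 * \<kappa> \<le> C1"
proof -
  show Q: "0 \<le> Q" using kappa_pos c_pos K_nonneg beta_pos by (simp add: Q_def)
  show M: "0 \<le> M"
    using c_pos K_nonneg beta_pos L_nonneg omega_nonneg[of \<epsilon>] omega_nonneg[of \<rho>] eps_pos rho_pos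
    by (simp add: M_def)
  show C0: "0 \<le> C0"
    using Q M nu_nonneg omega_nonneg[of \<epsilon>] eps_pos c_pos by (simp add: C0_def)
  then show C1: "0 < C1" "2 * \<kappa> \<le> C1" using kappa_pos by (auto simp: C1_def)
  show "0 \<le> C2" using C1 nu_nonneg beta_pos c_pos K_nonneg by (simp add: C2_def)
qed

lemma newton_op_close:
  assumes "newton_step x J x'"
  shows "norm (newton_op x J - A' x) \<le> (c + K) * \<omega> (r x)"
proof -
  define a where "a = c * \<omega> (r x)"
  have "0 \<le> a" using c_pos omega_nonneg r_nonneg by (simp add: a_def)
  then have "norm (a *\<^sub>R (id_blinfun :: 'a \<Rightarrow>\<^sub>L 'a)) \<le> a"
    using mult_left_mono[OF norm_blinfun_id_le] by force
  moreover have "newton_op x J - A' x = a *\<^sub>R id_blinfun + (J - A' x)"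
    by (simp add: newton_op_def a_def)
  moreover have "norm (J - A' x) \<le> K * \<omega> (r x)"
    using assms by (simp add: newton_step_def)
  ultimately have "norm (newton_op x J - A' x) \<le> a + K * \<omega> (r x)"
    by (metis norm_triangle_mono)
  then show ?thesis by (simp add: a_def distrib_right)
qed

text \<open>It is \<open>y\<close>, not \<open>x'\<close>, that lies in the domain of
  \<open>B\<close>, so monotonicity is used between \<open>y\<close> and \<open>p\<close>, at the
  cost of the inexactness \<open>e\<close>. Both \<open>e\<close> and the linearization error
  \<open>q\<close> carry a factor \<open>\<omega> (r x)\<close>, which cancels against the strong
  monotonicity modulus of \<open>H\<close>.\<close>

lemma step_length:
  assumes step: "newton_step x J x'"
    and pos: "0 < r x" "0 < \<omega> (r x)"
    and small: "r x \<le> \<epsilon> / 2" "2 * \<kappa> * r x \<le> \<rho>"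
  shows "norm (x' - x) \<le> C1 * r x"
proof -
  define H where "H = newton_op x J"
  define y where "y = resolvent B ((x' - H x') + (H x - A x))"
  obtain p where p: "p \<in> S" "norm (x - p) \<le> 2 * \<kappa> * r x"
    using near_solution[of x] pos small eps_pos by auto
  define e where "e = x' - y"
  define u where "u = x' - p"
  define w where "w = x - p"
  define q where "q = H w - (A x - A p)"
  have w: "norm w \<le> 2 * \<kappa> * r x" "norm w \<le> \<rho>" using p small by (auto simp: w_def)
  have e: "norm e \<le> \<nu> * \<omega> (r x) * r x"
    using step by (simp add: newton_step_def sub_residual_def e_def y_def H_def)
  have HA: "norm (H - A' x) \<le> (c + K) * \<omega> (r x)"
    unfolding H_def using step by (rule newton_op_close)
  have omega_eps: "\<omega> (r x) \<le> \<omega> \<epsilon>" using small eps_pos r_nonneg by (intro omega_le) auto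
  have q: "norm q \<le> Q * \<omega> (r x) * r x"
  proof -
    have q_eq: "q = (H - A' x) w + (A (x + - w) - A x - A' x (- w))"
      by (simp add: q_def w_def blinfun.diff_left blinfun.diff_right)
    have "norm ((H - A' x) w) \<le> (c + K) * \<omega> (r x) * (2 * \<kappa> * r x)"
      using HA w c_pos K_nonneg omega_nonneg[OF r_nonneg]
      by (intro order.trans[OF norm_blinfun] mult_mono) auto
    moreover have "norm (A (x + - w) - A x - A' x (- w)) \<le> \<beta> * \<omega> (norm w) * norm w"
      using taylor[of x "- w"] small w by simp
    moreover have "\<omega> (norm w) \<le> (2 * \<kappa> + 1) * \<omega> (r x)"
      using omega_le[OF _ w(1)] omega_mult[of "2 * \<kappa>" "r x"] kappa_pos r_nonneg by force
    then have "\<beta> * \<omega> (norm w) * norm w \<le> \<beta> * ((2 * \<kappa> + 1) * \<omega> (r x)) * (2 * \<kappa> * r x)"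
      using w beta_pos kappa_pos omega_nonneg[OF r_nonneg]
      by (intro mult_mono mult_nonneg_nonneg mult_left_mono) auto
    moreover have "(c + K) * \<omega> (r x) * (2 * \<kappa> * r x)
        + \<beta> * ((2 * \<kappa> + 1) * \<omega> (r x)) * (2 * \<kappa> * r x) = Q * \<omega> (r x) * r x"
      by (simp add: Q_def algebra_simps)
    ultimately show ?thesis
      unfolding q_eq using norm_triangle_ineq[of "(H - A' x) w"] by (smt (verit))
  qed
  have "norm H \<le> M"
  proof -
    have "norm H \<le> norm (H - A' x) + norm (A' x)"
      using norm_triangle_ineq[of "H - A' x" "A' x"] by simp
    also have "\<dots> \<le> (c + K) * \<omega> \<epsilon> + (L + \<beta> * \<omega> \<rho>)"
      using omega_eps c_pos K_nonneg
      by (intro add_mono norm_A'_le[OF small(1)] order.trans[OF HA] mult_left_mono) auto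
    finally show ?thesis by (simp add: M_def)
  qed
  then have Hu: "norm (H u) \<le> M * norm u"
    by (intro order.trans[OF norm_blinfun] mult_right_mono) auto
  have "0 \<le> (((x' - H x') + (H x - A x)) - y - (- A p)) \<bullet> (y - p)"
    using resolvent_mem[OF B_max, of "(x' - H x') + (H x - A x)"] p(1)
    unfolding y_def[symmetric] solution_iff by (rule B_mono)
  also have "((x' - H x') + (H x - A x)) - y - (- A p) = (e + q) - H u"
    by (simp add: e_def q_def u_def w_def blinfun.diff_right)
  also have "y - p = u - e" by (simp add: u_def e_def)
  finally have "H u \<bullet> u \<le> H u \<bullet> e + (e + q) \<bullet> (u - e)"
    by (simp add: inner_diff_left inner_diff_right)
  also have "\<dots> \<le> norm (H u) * norm e + (norm e + norm q) * (norm u + norm e)"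
    by (intro add_mono norm_cauchy_schwarz order.trans[OF norm_cauchy_schwarz] mult_mono
        norm_triangle_ineq norm_triangle_ineq4) auto
  finally have upper: "H u \<bullet> u \<le> norm (H u) * norm e + (norm e + norm q) * (norm u + norm e)" .
  have lower: "c * \<omega> (r x) * (norm u * norm u) \<le> H u \<bullet> u"
    using step unfolding newton_step_def H_def newton_op_def
    by (simp add: blinfun.add_left blinfun.scaleR_left inner_add_left
        power2_norm_eq_inner[symmetric] power2_eq_square)
  have "norm u \<le> C0 * r x"
  \<comment> \<open>The two cases produce the two summands of \<open>C0\<close>. In the second,
    \<open>norm u + norm e\<close> is at most twice \<open>norm u\<close>, so one factor
    \<open>norm u\<close> can be divided out.\<close>
  proof (cases "norm u \<le> norm e")
    case True
    have "norm u \<le> \<nu> * \<omega> \<epsilon> * r x"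
      using True e omega_eps nu_nonneg r_nonneg
      by (intro order.trans[OF True] order.trans[OF e] mult_right_mono mult_left_mono)
    also have "\<dots> \<le> C0 * r x"
      using constants_nonneg nu_nonneg c_pos r_nonneg by (intro mult_right_mono) (auto simp: C0_def)
    finally show ?thesis .
  next
    case False
    then have "0 < norm u" by (meson norm_ge_zero not_le order.strict_trans1)
    have "c * \<omega> (r x) * (norm u * norm u)
        \<le> (M * norm u) * norm e + (norm e + norm q) * (norm u + norm u)"
      using False constants_nonneg
      by (intro order.trans[OF lower] order.trans[OF upper] add_mono mult_mono Hu) auto
    then have "norm u * (c * \<omega> (r x) * norm u) \<le> norm u * (M * norm e + 2 * (norm e + norm q))"
      by (simp add: algebra_simps)
    then have "c * \<omega> (r x) * norm u \<le> M * norm e + 2 * (norm e + norm q)"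
      using \<open>0 < norm u\<close> mult_le_cancel_left_pos by blast
    also have "\<dots> \<le> M * (\<nu> * \<omega> (r x) * r x) + 2 * (\<nu> * \<omega> (r x) * r x + Q * \<omega> (r x) * r x)"
      using e q constants_nonneg by (intro add_mono mult_left_mono) auto
    also have "\<dots> = \<omega> (r x) * ((M * \<nu> + 2 * (\<nu> + Q)) * r x)" by (simp add: algebra_simps)
    finally have "\<omega> (r x) * (c * norm u) \<le> \<omega> (r x) * ((M * \<nu> + 2 * (\<nu> + Q)) * r x)"
      by (simp add: mult_ac)
    then have "c * norm u \<le> (M * \<nu> + 2 * (\<nu> + Q)) * r x"
      using pos(2) mult_le_cancel_left_pos by blast
    then have "norm u \<le> (M * \<nu> + 2 * (\<nu> + Q)) / c * r x"
      using c_pos by (simp add: field_simps)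
    also have "\<dots> \<le> C0 * r x"
      using nu_nonneg omega_nonneg[of \<epsilon>] eps_pos r_nonneg
      by (intro mult_right_mono) (auto simp: C0_def)
    finally show ?thesis .
  qed
  moreover have "x' - x = u - w" by (simp add: u_def w_def)
  ultimately show ?thesis
    using norm_triangle_ineq4[of u w] w(1) by (simp add: C1_def distrib_right)
qed

text \<open>The resolvent points defining the two residuals at \<open>x'\<close> have arguments that
  differ only by the Taylor error and the error of \<open>H\<close> as a derivative;
  nonexpansiveness carries this over to the residual.\<close>

lemma step_residual:
  assumes step: "newton_step x J x'"
    and small: "r x \<le> \<epsilon> / 2" "C1 * r x \<le> \<rho>"
    and len: "norm (x' - x) \<le> C1 * r x"
  shows "r x' \<le> C2 * \<omega> (r x) * r x"
proof -
  define H where "H = newton_op x J"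
  define y where "y = resolvent B ((x' - H x') + (H x - A x))"
  define s where "s = x' - x"
  have "r x' \<le> norm (x' - y) + norm (y - resolvent B (x' - A x'))"
    unfolding residual_def using norm_triangle_ineq[of "x' - y" "y - resolvent B (x' - A x')"] by simp
  also have "norm (x' - y) \<le> \<nu> * \<omega> (r x) * r x"
    using step by (simp add: newton_step_def sub_residual_def y_def H_def)
  also have "norm (y - resolvent B (x' - A x')) \<le> norm (((x' - H x') + (H x - A x)) - (x' - A x'))"
    unfolding y_def by (rule resolvent_nonexpansive[OF B_max])
  also have "((x' - H x') + (H x - A x)) - (x' - A x') = (A (x + s) - A x - A' x s) - (H - A' x) s"
    by (simp add: s_def blinfun.diff_left blinfun.diff_right)
  also have "norm \<dots> \<le> norm (A (x + s) - A x - A' x s) + norm ((H - A' x) s)"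
    by (rule norm_triangle_ineq4)
  also have "norm (A (x + s) - A x - A' x s) \<le> \<beta> * \<omega> (norm s) * norm s"
    using small len by (intro taylor) (auto simp: s_def)
  also have "norm ((H - A' x) s) \<le> (c + K) * \<omega> (r x) * norm s"
    using newton_op_close[OF step] unfolding H_def
    by (intro order.trans[OF norm_blinfun] mult_right_mono) auto
  also have "\<beta> * \<omega> (norm s) * norm s + (c + K) * \<omega> (r x) * norm s
      \<le> \<beta> * ((C1 + 1) * \<omega> (r x)) * (C1 * r x) + (c + K) * \<omega> (r x) * (C1 * r x)"
  proof -
    have "\<omega> (norm s) \<le> (C1 + 1) * \<omega> (r x)"
      using omega_le[of "norm s" "C1 * r x"] len omega_mult[of C1 "r x"] constants_nonneg r_nonneg[of x]
      by (simp add: s_def)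
    then show ?thesis
      using len beta_pos c_pos K_nonneg constants_nonneg omega_nonneg[OF r_nonneg]
      by (intro add_mono mult_mono mult_nonneg_nonneg mult_left_mono) (auto simp: s_def)
  qed
  finally show ?thesis by (simp add: C2_def algebra_simps)
qed

text \<open>
  If \<open>\<omega> (r x) = 0\<close> then \<open>\<omega>\<close> vanishes identically, there is no regularization and the step
  may be arbitrarily long. However, if \<open>A\<close> agrees with the monotone affine map \<open>aff\<close> at a
  solution, it does so within distance \<open>\<rho>\<close>. The segment from a solution \<open>p\<close> near \<open>x\<close> to \<open>x'\<close>
  consists of solutions of the affine problem, so the agreement propagates along it in short steps.
\<close>
lemma step_degenerate:
  assumes step: "newton_step x J x'"
    and pos: "0 < r x" and zero: "\<omega> (r x) = 0"
    and small: "r x \<le> \<epsilon> / 2" "2 * \<kappa> * r x \<le> \<rho>"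
  shows "r x' = 0"
proof -
  have omega0: "\<omega> s = 0" if "0 \<le> s" for s
  proof -
    obtain n where "s \<le> real n * r x" using reals_Archimedean3[OF pos] less_imp_le by blast
    then have "\<omega> s \<le> real n * \<omega> (r x)"
      using omega_le[OF that] omega_of_nat_mult[OF r_nonneg[of x], of n] by force
    then show ?thesis using zero omega_nonneg[OF that] by simp
  qed
  have J_eq: "J = A' x" using step zero by (simp add: newton_step_def)
  have psd: "0 \<le> A' x v \<bullet> v" for v
    using step unfolding newton_step_def J_eq by blast
  have J: "newton_op x J = A' x"
    using zero by (simp add: newton_op_def J_eq)
  define aff where "aff = (\<lambda>z. A x + A' x (z - x))"
  have aff_diff: "aff z - aff z' = A' x (z - z')" for z z'
    by (simp add: aff_def blinfun.diff_right)
  have near: "r z \<le> \<epsilon> \<and> A z = aff z"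
    if "r y \<le> \<epsilon> / 2" "A y = aff y" "norm (z - y) \<le> \<rho>" for y z
  proof
    show "r z \<le> \<epsilon>" using r_le_eps_near[OF that(1,3)] by simp
    have "A' y = A' x"
      using modulus[of y x] that(1) small eps_pos omega0 by simp
    then have "A z - A y = A' x (z - y)"
      using taylor[OF that(1,3)] omega0 by simp
    then show "A z = aff z" using that(2) aff_diff[of z y] by (simp add: algebra_simps)
  qed
  obtain p where p: "p \<in> S" "norm (x - p) \<le> 2 * \<kappa> * r x"
    using near_solution[of x] pos small eps_pos by auto
  define u where "u = x' - p"
  have aff_p: "A p = aff p"
    using near[of x p] small p by (simp add: aff_def norm_minus_commute)
  have Bp: "- aff p \<in> B p" using p(1) aff_p by (simp add: solution_iff)
  have x'_eq: "x' = resolvent B (x' - aff x')"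
    using step zero unfolding newton_step_def sub_residual_def J
    by (simp add: aff_def blinfun.diff_right algebra_simps)
  have Bx': "- aff x' \<in> B x'"
    using resolvent_mem[OF B_max, of "x' - aff x'"] unfolding x'_eq[symmetric] by simp
  have "0 \<le> (- aff x' - - aff p) \<bullet> (x' - p)" by (rule B_mono[OF Bx' Bp])
  also have "- aff x' - - aff p = - A' x u" using aff_diff[of x' p] by (simp add: u_def algebra_simps)
  \<comment> \<open>Monotonicity of \<open>B\<close> gives one sign and positive semidefiniteness
    the other.\<close>
  finally have Auu: "A' x u \<bullet> u = 0" using psd[of u] by (simp add: u_def)
  have seg: "- aff (p + \<theta> *\<^sub>R u) \<in> B (p + \<theta> *\<^sub>R u)" if "0 \<le> \<theta>" "\<theta> \<le> 1" for \<theta>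
  proof (rule maximal_monotone_mem[OF B_max])
    fix y v assume v: "v \<in> B y"
    have affs: "aff (p + t *\<^sub>R u) = aff p + t *\<^sub>R A' x u" for t
      using aff_diff[of "p + t *\<^sub>R u" p] by (simp add: blinfun.scaleR_right algebra_simps)
    have x': "x' = p + 1 *\<^sub>R u" by (simp add: u_def)
    \<comment> \<open>By \<open>Auu\<close> the term quadratic in \<open>\<theta>\<close> vanishes,
      so the pairing is affine in \<open>\<theta>\<close> and interpolates its nonnegative end
      values.\<close>
    have "(v - - aff (p + \<theta> *\<^sub>R u)) \<bullet> (y - (p + \<theta> *\<^sub>R u))
        = (1 - \<theta>) * ((v - - aff p) \<bullet> (y - p)) + \<theta> * ((v - - aff x') \<bullet> (y - x'))"
      unfolding x' affs using Auu
      by (simp add: inner_add_left inner_add_right inner_diff_left inner_diff_right algebra_simps)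
    also have "0 \<le> \<dots>"
      using that by (intro add_nonneg_nonneg mult_nonneg_nonneg B_mono[OF v Bp] B_mono[OF v Bx']) auto
    finally show "0 \<le> (v - - aff (p + \<theta> *\<^sub>R u)) \<bullet> (y - (p + \<theta> *\<^sub>R u))" .
  qed
  obtain N :: nat where N: "norm u \<le> real N * \<rho>" "0 < N"
  proof -
    obtain n where "norm u < real n * \<rho>" using reals_Archimedean3[OF rho_pos] by blast
    then show thesis
      using rho_pos by (intro that[of "Suc n"]) (auto simp: algebra_simps)
  qed
  \<comment> \<open>Agreement at one grid point makes it a true solution by \<open>seg\<close>, so
    its residual is zero and \<open>near\<close> reaches the next grid point.\<close>
  have "A (p + (real k / real N) *\<^sub>R u) = aff (p + (real k / real N) *\<^sub>R u)" if "k \<le> N" for k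
    using that
  proof (induction k)
    case (Suc k)
    define y where "y = p + (real k / real N) *\<^sub>R u"
    define z where "z = p + (real (Suc k) / real N) *\<^sub>R u"
    have Ay: "A y = aff y" using Suc by (simp add: y_def)
    have "- A y \<in> B y"
      using seg[of "real k / real N"] Suc.prems N unfolding Ay by (simp add: y_def)
    then have "r y = 0" by (simp add: r_eq_0_iff solution_iff)
    have "z - y = (1 / real N) *\<^sub>R u"
      by (simp add: y_def z_def add_divide_distrib scaleR_add_left)
    then have "norm (z - y) \<le> \<rho>" using N by (simp add: field_simps)
    then have "A z = aff z" using near[of y z] Ay \<open>r y = 0\<close> eps_pos by simp
    then show ?case by (simp add: z_def)
  qed (use aff_p in simp)
  from this[of N] have "A x' = aff x'" using N by (simp add: u_def)
  then show "r x' = 0" using x'_eq by (simp add: residual_def)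
qed

section \<open>Superlinear convergence of the iteration\<close>

definition \<delta>0 where "\<delta>0 = min (\<epsilon> / 2) (\<rho> / C1)"


text \<open>The length bound is conditional because a step with \<open>\<omega> (r x) = 0\<close>
  may be long; such a step lands in \<open>S\<close>, after which the iteration is constant.\<close>

lemma step:
  assumes "if r x = 0 then x' = x else newton_step x J x'" and small: "r x \<le> \<delta>0"
  shows "r x' \<le> C2 * \<omega> (r x) * r x" and "r x' \<noteq> 0 \<Longrightarrow> norm (x' - x) \<le> C1 * r x"
proof -
  have small': "r x \<le> \<epsilon> / 2" "C1 * r x \<le> \<rho>"
    using small constants_nonneg by (auto simp: \<delta>0_def field_simps)
  moreover have "2 * \<kappa> * r x \<le> C1 * r x"
    using constants_nonneg r_nonneg by (intro mult_right_mono) auto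
  ultimately have small'': "2 * \<kappa> * r x \<le> \<rho>" by simp
  consider "r x = 0" | "r x \<noteq> 0" "\<omega> (r x) = 0" | "0 < r x" "0 < \<omega> (r x)"
    using r_nonneg omega_nonneg by (metis less_eq_real_def)
  then have "r x' = 0 \<or> r x' \<le> C2 * \<omega> (r x) * r x \<and> norm (x' - x) \<le> C1 * r x"
  proof cases
    case 1
    then show ?thesis using assms(1) by simp
  next
    case 2
    then show ?thesis
      using step_degenerate assms(1) small' small'' r_nonneg[of x] by simp
  next
    case 3
    then have "newton_step x J x'" using assms(1) by simp
    then show ?thesis using step_length step_residual 3 small' small'' by blast
  qed
  then show "r x' \<le> C2 * \<omega> (r x) * r x" "r x' \<noteq> 0 \<Longrightarrow> norm (x' - x) \<le> C1 * r x"
    using constants_nonneg omega_nonneg[OF r_nonneg] r_nonneg by auto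
qed

lemma omega_tendsto_zero:
  assumes "f \<longlonglongrightarrow> 0" "\<And>n::nat. 0 \<le> f n"
  shows "(\<lambda>n. \<omega> (f n)) \<longlonglongrightarrow> 0"
  using continuous_on_tendsto_compose[OF omega_cont assms(1)] assms(2) by (simp add: omega_zero)

lemma superlinear_convergence:
  "\<exists>\<delta>>0. \<forall>x J. (\<forall>t. if r (x t) = 0 then x (Suc t) = x t else newton_step (x t) (J t) (x (Suc t)))
       \<and> r (x 0) \<le> \<delta> \<longrightarrow>
     (\<lambda>t. r (x (Suc t))) \<in> o(\<lambda>t. r (x t)) \<and>
     (\<lambda>t. infdist (x (Suc t)) S) \<in> o(\<lambda>t. infdist (x t) S) \<and>
     (\<exists>p\<in>S. x \<longlonglongrightarrow> p)"
proof -
  have \<delta>0: "0 < \<delta>0" "\<delta>0 \<le> \<epsilon>" using eps_pos rho_pos constants_nonneg by (auto simp: \<delta>0_def)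
  \<comment> \<open>Continuity of \<open>\<omega>\<close> at zero gives a threshold, chosen before
    the sequence, below which every step at least halves the residual.\<close>
  have "(\<lambda>n. C2 * \<omega> (inverse (real (Suc n)))) \<longlonglongrightarrow> C2 * 0"
    by (intro tendsto_intros omega_tendsto_zero LIMSEQ_inverse_real_of_nat) simp
  then have "\<forall>\<^sub>F n in sequentially. C2 * \<omega> (inverse (real (Suc n))) < 1 / 2"
    by (rule order_tendstoD) simp
  then obtain n where n: "C2 * \<omega> (inverse (real (Suc n))) < 1 / 2"
    using eventually_happens' sequentially_bot by blast
  define \<delta> where "\<delta> = min \<delta>0 (inverse (real (Suc n)))"
  have "0 < \<delta>" using \<delta>0 by (simp add: \<delta>_def)
  moreover have "(\<lambda>t. r (x (Suc t))) \<in> o(\<lambda>t. r (x t)) \<and>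
     (\<lambda>t. infdist (x (Suc t)) S) \<in> o(\<lambda>t. infdist (x t) S) \<and> (\<exists>p\<in>S. x \<longlonglongrightarrow> p)"
    if iter: "\<And>t. if r (x t) = 0 then x (Suc t) = x t else newton_step (x t) (J t) (x (Suc t))"
      and init: "r (x 0) \<le> \<delta>" for x J
  proof (intro conjI)
    have half: "r (x (Suc t)) \<le> r (x t) / 2" if "r (x t) \<le> \<delta>" for t
    proof -
      have "C2 * \<omega> (r (x t)) \<le> C2 * \<omega> (inverse (real (Suc n)))"
        using that r_nonneg constants_nonneg by (intro mult_left_mono omega_le) (auto simp: \<delta>_def)
      then have "C2 * \<omega> (r (x t)) \<le> 1 / 2" using n by linarith
      then have "C2 * \<omega> (r (x t)) * r (x t) \<le> 1 / 2 * r (x t)"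
        using r_nonneg by (rule mult_right_mono)
      then show ?thesis using step(1)[OF iter, of t] that by (simp add: \<delta>_def)
    qed
    have geom: "r (x t) \<le> \<delta> * (1 / 2) ^ t" for t
    proof (induction t)
      case (Suc t)
      have "\<delta> * (1 / 2) ^ t \<le> \<delta> * 1"
        using \<open>0 < \<delta>\<close> by (intro mult_left_mono power_le_one) auto
      with Suc half[of t] show ?case by simp
    qed (use init in simp)
    have small: "r (x t) \<le> \<delta>0" for t
    proof -
      have "\<delta> * (1 / 2) ^ t \<le> \<delta> * 1"
        using \<open>0 < \<delta>\<close> by (intro mult_left_mono power_le_one) auto
      then show ?thesis using geom[of t] by (simp add: \<delta>_def)
    qed
    have r_lim: "(\<lambda>t. r (x t)) \<longlonglongrightarrow> 0"
    proof (rule tendsto_sandwich[of "\<lambda>_. 0" _ _ "\<lambda>t. \<delta> * (1 / 2) ^ t"])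
      show "(\<lambda>t. \<delta> * (1 / 2) ^ t) \<longlonglongrightarrow> 0"
        by (intro tendsto_mult_right_zero LIMSEQ_power_zero) simp
      show "(\<lambda>t. 0 :: real) \<longlonglongrightarrow> 0" by simp
    qed (use r_nonneg geom in auto)
    \<comment> \<open>Both rates follow from this: the factor \<open>\<omega> (r (x t))\<close>
      tends to zero.\<close>
    have little_o: "f \<in> o(g)"
      if "\<And>t. 0 \<le> f t" "\<And>t. 0 \<le> g t" "\<And>t. f t \<le> C * \<omega> (r (x t)) * g t"
      for f g :: "nat \<Rightarrow> real" and C
    proof (rule landau_o.smallI)
      fix a :: real assume "0 < a"
      have "(\<lambda>t. C * \<omega> (r (x t))) \<longlonglongrightarrow> C * 0"
        using r_lim r_nonneg by (intro tendsto_intros omega_tendsto_zero)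
      then have "\<forall>\<^sub>F t in sequentially. C * \<omega> (r (x t)) < a"
        by (rule order_tendstoD) (use \<open>0 < a\<close> in simp)
      then show "\<forall>\<^sub>F t in sequentially. norm (f t) \<le> a * norm (g t)"
      proof eventually_elim
        case (elim t)
        have "f t \<le> a * g t"
          by (rule order.trans[OF that(3) mult_right_mono[OF less_imp_le[OF elim] that(2)]])
        then show ?case using that by simp
      qed
    qed
    show "(\<lambda>t. r (x (Suc t))) \<in> o(\<lambda>t. r (x t))"
      using r_nonneg step(1)[OF iter small] by (intro little_o) auto
    show "(\<lambda>t. infdist (x (Suc t)) S) \<in> o(\<lambda>t. infdist (x t) S)"
    proof (rule little_o)
      fix t
      have "infdist (x (Suc t)) S \<le> \<kappa> * r (x (Suc t))"
        using small \<delta>0 by (intro error_bound) (meson order.trans)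
      also have "\<dots> \<le> \<kappa> * (C2 * \<omega> (r (x t)) * r (x t))"
        using step(1)[OF iter small] kappa_pos by (intro mult_left_mono) auto
      also have "\<dots> \<le> \<kappa> * (C2 * \<omega> (r (x t)) * ((2 + L) * infdist (x t) S))"
        using kappa_pos constants_nonneg omega_nonneg r_nonneg small \<delta>0
        by (intro mult_left_mono r_le_infdist mult_nonneg_nonneg) (auto intro: order.trans)
      finally show "infdist (x (Suc t)) S \<le> (\<kappa> * C2 * (2 + L)) * \<omega> (r (x t)) * infdist (x t) S"
        by (simp add: mult_ac)
    qed (auto intro: infdist_nonneg)
    have "convergent x"
    \<comment> \<open>Either the sequence is eventually constant, or no residual vanishes and the
      length bound of \<open>step\<close> holds at every index.\<close>
    proof (cases "\<exists>t. r (x t) = 0")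
      case True
      then obtain t where t: "r (x t) = 0" by blast
      have "x (s + t) = x t" for s
        by (induction s) (use t iter in \<open>force+\<close>)
      then have "(\<lambda>s. x (s + t)) \<longlonglongrightarrow> x t" by simp
      then show ?thesis unfolding convergent_def using LIMSEQ_offset by blast
    next
      case False
      show ?thesis
      proof (rule convergent_of_geometric_steps)
        fix t
        have "norm (x (Suc t) - x t) \<le> C1 * r (x t)" using False step(2)[OF iter small] by blast
        also have "\<dots> \<le> C1 * (\<delta> * (1 / 2) ^ t)"
          using geom constants_nonneg by (intro mult_left_mono) auto
        finally show "norm (x (Suc t) - x t) \<le> (C1 * \<delta>) * (1 / 2) ^ t" by (simp add: mult_ac)
      qed auto
    qed
    then obtain p where p: "x \<longlonglongrightarrow> p" by (auto simp: convergent_def)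
    then have "(\<lambda>t. r (x t)) \<longlonglongrightarrow> r p"
      using continuous_on_tendsto_compose[OF r_continuous] by simp
    then have "r p = 0" using r_lim LIMSEQ_unique by blast
    then show "\<exists>p\<in>S. x \<longlonglongrightarrow> p" using p r_eq_0_iff by blast
  qed
  ultimately show ?thesis by blast
qed

end

theorem corollaryA1:
  fixes A :: "'a::{real_inner, complete_space} \<Rightarrow> 'a"
    and A' :: "'a \<Rightarrow> 'a \<Rightarrow>\<^sub>L 'a"
    and B :: "'a \<Rightarrow> 'a set"
    and V :: "'a set"
    and \<omega>\<^sub>1 \<omega>\<^sub>2 :: "real \<Rightarrow> real"
    and \<epsilon> \<kappa> L c \<nu> \<beta>\<^sub>1 K :: real
  assumes A_deriv: "\<And>x. (A has_derivative blinfun_apply (A' x)) (at x)"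
    and A_C1: "continuous_on UNIV A'"
    and B_max: "maximal_monotone B"
    and S_nonempty: "solution_set A B \<noteq> {}"
    and S_closed: "closed (solution_set A B)"
    and eps_kappa: "\<epsilon> > 0" "\<kappa> > 0"
    and V_def: "V = {x. residual A B x \<le> \<epsilon>}"
    and error_bound: "\<And>x. x \<in> V \<Longrightarrow> infdist x (solution_set A B) \<le> \<kappa> * residual A B x"
    and A_lipschitz: "L-lipschitz_on V A"
    and A'_unif_cont: "uniformly_continuous_on V A'"
    and omega1_nonneg: "\<And>s. s \<ge> 0 \<Longrightarrow> \<omega>\<^sub>1 s \<ge> 0"
    and omega1_mono: "mono_on {0..} \<omega>\<^sub>1"
    and omega1_subadd: "\<And>s t. s \<ge> 0 \<Longrightarrow> t \<ge> 0 \<Longrightarrow> \<omega>\<^sub>1 (s + t) \<le> \<omega>\<^sub>1 s + \<omega>\<^sub>1 t"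
    and omega1_zero: "\<omega>\<^sub>1 0 = 0" "(\<omega>\<^sub>1 \<longlongrightarrow> 0) (at_right 0)"
    and omega1_modulus: "\<And>x y. x \<in> V \<Longrightarrow> y \<in> V \<Longrightarrow> norm (A' x - A' y) \<le> \<omega>\<^sub>1 (norm (x - y))"
    and omega2_nonneg: "\<And>s. s \<ge> 0 \<Longrightarrow> \<omega>\<^sub>2 s \<ge> 0"
    and omega2_mono: "mono_on {0..} \<omega>\<^sub>2"
    and omega2_subadd: "\<And>s t. s \<ge> 0 \<Longrightarrow> t \<ge> 0 \<Longrightarrow> \<omega>\<^sub>2 (s + t) \<le> \<omega>\<^sub>2 s + \<omega>\<^sub>2 t"
    and omega2_cont: "continuous_on {0..} \<omega>\<^sub>2"
    and omega2_zero: "\<omega>\<^sub>2 0 = 0"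
    and c_nu: "c > 0" "\<nu> \<ge> 0"
    and beta1: "\<beta>\<^sub>1 > 0" "\<And>s. s \<ge> 0 \<Longrightarrow> \<omega>\<^sub>1 s \<le> \<beta>\<^sub>1 * \<omega>\<^sub>2 s"
  shows "\<exists>\<delta>>0. \<forall>x \<mu> J.
     newton_sequence A A' B \<omega>\<^sub>2 c \<nu> K x \<mu> J \<and> residual A B (x 0) \<le> \<delta> \<longrightarrow>
       (\<lambda>t. residual A B (x (Suc t))) \<in> o(\<lambda>t. residual A B (x t)) \<and>
       (\<lambda>t. infdist (x (Suc t)) (solution_set A B)) \<in> o(\<lambda>t. infdist (x t) (solution_set A B)) \<and>
       (\<exists>p\<in>solution_set A B. x \<longlonglongrightarrow> p)"
proof -
  \<comment> \<open>The statement leaves the sign of \<open>K\<close> open; enlarging it to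
    \<open>max K 0\<close> only weakens the condition on \<open>J\<close>.\<close>
  interpret newton_setting A A' B \<omega>\<^sub>2 \<epsilon> \<kappa> L \<beta>\<^sub>1 c \<nu> "max K 0"
  proof
    show "norm (A' x - A' y) \<le> \<beta>\<^sub>1 * \<omega>\<^sub>2 (norm (x - y))"
      if "residual A B x \<le> \<epsilon>" "residual A B y \<le> \<epsilon>" for x y
      using omega1_modulus[of x y] beta1(2)[of "norm (x - y)"] that by (simp add: V_def)
  qed (use assms in \<open>auto simp: V_def\<close>)
  have step: "if r (x t) = 0 then x (Suc t) = x t else newton_step (x t) (J t) (x (Suc t))"
    if "newton_sequence A A' B \<omega>\<^sub>2 c \<nu> K x \<mu> J" for x \<mu> J t
  proof (cases "r (x t) = 0")
    case False
    have "K * \<omega>\<^sub>2 (r (x t)) \<le> max K 0 * \<omega>\<^sub>2 (r (x t))"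
      using omega2_nonneg[OF r_nonneg] by (intro mult_right_mono) auto
    moreover have "\<mu> t = c * \<omega>\<^sub>2 (r (x t)) \<and> (\<forall>v. 0 \<le> J t v \<bullet> v) \<and>
        norm (J t - A' (x t)) \<le> K * \<omega>\<^sub>2 (r (x t)) \<and>
        sub_residual A B (\<mu> t *\<^sub>R id_blinfun + J t) (x t) (x (Suc t)) \<le> \<nu> * \<omega>\<^sub>2 (r (x t)) * r (x t)"
      using spec[OF that[unfolded newton_sequence_def Let_def], of t] False by argo
    ultimately have "newton_step (x t) (J t) (x (Suc t))"
      unfolding newton_step_def newton_op_def by auto
    then show ?thesis using False by simp
  qed (use that in \<open>simp add: newton_sequence_def Let_def\<close>)
  show ?thesis using superlinear_convergence step by blast
qed

end
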